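(* The satisfiability problem for HyperCTL$^*$ formulas in the $\forall\exists$ fragment is undecidable: there is no algorithm that, given a HyperCTL$^*$ formula in negation normal form with exactly one existential path quantifier occurring in the scope of a single universal path quantifier, decides whether some $AP$-labeled tree satisfies it.
   Context: A tree is a partially ordered infinite set of nodes $S$ with a least element (root) such that each node's ancestors are totally ordered; $s'$ is the direct ancestor of $s$ if $s'<s$ with nothing strictly between. An $AP$-labeled tree has $L:S\to2^{AP}$. A path is an infinite sequence $s_0s_1\dots$ with $s_i$ the direct ancestor of $s_{i+1}$; $Paths(\mathcal T)$ are the paths from the root; $p[0,i]$ is the prefix up to $i$. HyperCTL$^*$ syntax: $\varphi ::= a_\pi\mid\neg\varphi\mid\varphi\vee\varphi\mid\mathsf X\varphi\mid\varphi\mathsf U\varphi\mid\exists\pi.\varphi$. Semantics under a path assignment $\Pi$ and position $i$: $a_\pi$ holds iff $a\in L(\Pi(\pi)[i])$; Boolean, $\mathsf X$, $\mathsf U$ as in LTL over positions; $\Pi,i\models\exists\pi.\varphi$ iff some $p\in Paths(\mathcal T)$ with $p[0,i]=\Pi(\varepsilon)[0,i]$ ($\varepsilon$ the most recently quantified path; no constraint if none) satisfies $\Pi[\pi\mapsto p,\varepsilon\mapsto p],i\models\varphi$; $\mathcal T\models\varphi$ iff $\emptyset,0\models\varphi$. Negation normal form: negation only in front of atoms, using additionally $\wedge$, $\forall\pi$ (dual of $\exists\pi$) and release $\varphi\mathsf R\psi\equiv\neg(\neg\varphi\mathsf U\neg\psi)$.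
   Formalization: Trees are required to have at least one path from the root (otherwise a root with infinitely many leaf children satisfies every formula of the fragment); nodes are taken from an arbitrary fixed infinite type, and a large enough type gives unrestricted satisfiability. *)

theory Defs
  imports Main "HOL-Library.Nat_Bijection"
begin

section \<open>Trees and paths\<close>

definition strict_anc :: "'n rel \<Rightarrow> 'n \<Rightarrow> 'n \<Rightarrow> bool" where
  "strict_anc r s t \<longleftrightarrow> (s, t) \<in> r \<and> s \<noteq> t"

definition is_root :: "'n set \<Rightarrow> 'n rel \<Rightarrow> 'n \<Rightarrow> bool" where
  "is_root S r x \<longleftrightarrow> x \<in> S \<and> (\<forall>s\<in>S. (x, s) \<in> r)"

definition is_tree :: "'n set \<Rightarrow> 'n rel \<Rightarrow> bool" where
  "is_tree S r \<longleftrightarrow>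
     infinite S \<and> r \<subseteq> S \<times> S \<and> partial_order_on S r \<and>
     (\<exists>x. is_root S r x) \<and>
     (\<forall>s\<in>S. total_on {t. strict_anc r t s} r)"

definition direct_anc :: "'n rel \<Rightarrow> 'n \<Rightarrow> 'n \<Rightarrow> bool" where
  "direct_anc r s t \<longleftrightarrow>
     strict_anc r s t \<and> \<not> (\<exists>u. strict_anc r s u \<and> strict_anc r u t)"

definition Paths :: "'n set \<Rightarrow> 'n rel \<Rightarrow> (nat \<Rightarrow> 'n) set" where
  "Paths S r = {p. is_root S r (p 0) \<and> (\<forall>i. direct_anc r (p i) (p (Suc i)))}"


section \<open>HyperCTL*\<close>

type_synonym ap = nat
type_synonym pvar = nat

text \<open>The syntax contains the dual operators needed for negation normal form as
  constructors.\<close>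

datatype hyperctl =
    Atom ap pvar
  | Neg hyperctl
  | Or hyperctl hyperctl
  | And hyperctl hyperctl
  | X hyperctl
  | U hyperctl hyperctl
  | R hyperctl hyperctl
  | ExP pvar hyperctl
  | AllP pvar hyperctl

text \<open>The most recently quantified path is the separate argument \<open>e\<close>, which is \<open>None\<close>
  before any quantification. Atoms over unassigned path variables, which do not occur in the
  evaluation of closed formulas, are false by convention.\<close>

fun agree :: "(nat \<Rightarrow> 'n) option \<Rightarrow> nat \<Rightarrow> (nat \<Rightarrow> 'n) \<Rightarrow> bool" where
  "agree None i p \<longleftrightarrow> True"
| "agree (Some q) i p \<longleftrightarrow> (\<forall>j\<le>i. p j = q j)"

primrec sem :: "'n set \<Rightarrow> 'n rel \<Rightarrow> ('n \<Rightarrow> ap set) \<Rightarrow> (pvar \<rightharpoonup> (nat \<Rightarrow> 'n)) \<Rightarrow> (nat \<Rightarrow> 'n) option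
    \<Rightarrow> nat \<Rightarrow> hyperctl \<Rightarrow> bool" where
  "sem S r L P e i (Atom a x) \<longleftrightarrow> (\<exists>p. P x = Some p \<and> a \<in> L (p i))"
| "sem S r L P e i (Neg \<phi>) \<longleftrightarrow> \<not> sem S r L P e i \<phi>"
| "sem S r L P e i (Or \<phi> \<psi>) \<longleftrightarrow> sem S r L P e i \<phi> \<or> sem S r L P e i \<psi>"
| "sem S r L P e i (And \<phi> \<psi>) \<longleftrightarrow> sem S r L P e i \<phi> \<and> sem S r L P e i \<psi>"
| "sem S r L P e i (X \<phi>) \<longleftrightarrow> sem S r L P e (Suc i) \<phi>"
| "sem S r L P e i (U \<phi> \<psi>) \<longleftrightarrow>
     (\<exists>j\<ge>i. sem S r L P e j \<psi> \<and> (\<forall>k. i \<le> k \<and> k < j \<longrightarrow> sem S r L P e k \<phi>))"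
| "sem S r L P e i (R \<phi> \<psi>) \<longleftrightarrow>
     (\<forall>j\<ge>i. sem S r L P e j \<psi> \<or> (\<exists>k. i \<le> k \<and> k < j \<and> sem S r L P e k \<phi>))"
| "sem S r L P e i (ExP x \<phi>) \<longleftrightarrow>
     (\<exists>p\<in>Paths S r. agree e i p \<and> sem S r L (P(x \<mapsto> p)) (Some p) i \<phi>)"
| "sem S r L P e i (AllP x \<phi>) \<longleftrightarrow>
     (\<forall>p\<in>Paths S r. agree e i p \<longrightarrow> sem S r L (P(x \<mapsto> p)) (Some p) i \<phi>)"

lemma sem_R_dual: "sem S r L P e i (R \<phi> \<psi>) \<longleftrightarrow> sem S r L P e i (Neg (U (Neg \<phi>) (Neg \<psi>)))"
  by auto

lemma sem_AllP_dual: "sem S r L P e i (AllP x \<phi>) \<longleftrightarrow> sem S r L P e i (Neg (ExP x (Neg \<phi>)))"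
  by auto

definition models :: "'n set \<Rightarrow> 'n rel \<Rightarrow> ('n \<Rightarrow> ap set) \<Rightarrow> hyperctl \<Rightarrow> bool" where
  "models S r L \<phi> \<longleftrightarrow> sem S r L Map.empty None 0 \<phi>"

text \<open>As usual for computation trees, a model must have at least one path. The conditions in
  \<open>is_tree\<close> alone do not ensure this: in a root with infinitely many leaves as its children,
  every universal path quantifier would be vacuously true.
  HOL cannot quantify over types inside a formula, so the type of which the nodes are elements
  is a parameter. By a Loewenheim-Skolem argument, trees of at most continuum size suffice for
  satisfiability, so every type of at least that size gives unrestricted satisfiability.\<close>

definition satisfiable :: "'n itself \<Rightarrow> hyperctl \<Rightarrow> bool" where
  "satisfiable _ \<phi> \<longleftrightarrow>
     (\<exists>(S :: 'n set) r L. is_tree S r \<and> Paths S r \<noteq> {} \<and> models S r L \<phi>)"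


section \<open>The forall-exists fragment\<close>

primrec free_vars :: "hyperctl \<Rightarrow> pvar set" where
  "free_vars (Atom a x) = {x}"
| "free_vars (Neg \<phi>) = free_vars \<phi>"
| "free_vars (Or \<phi> \<psi>) = free_vars \<phi> \<union> free_vars \<psi>"
| "free_vars (And \<phi> \<psi>) = free_vars \<phi> \<union> free_vars \<psi>"
| "free_vars (X \<phi>) = free_vars \<phi>"
| "free_vars (U \<phi> \<psi>) = free_vars \<phi> \<union> free_vars \<psi>"
| "free_vars (R \<phi> \<psi>) = free_vars \<phi> \<union> free_vars \<psi>"
| "free_vars (ExP x \<phi>) = free_vars \<phi> - {x}"
| "free_vars (AllP x \<phi>) = free_vars \<phi> - {x}"

primrec nnf :: "hyperctl \<Rightarrow> bool" where
  "nnf (Atom a x) \<longleftrightarrow> True"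
| "nnf (Neg \<phi>) \<longleftrightarrow> (\<exists>a x. \<phi> = Atom a x)"
| "nnf (Or \<phi> \<psi>) \<longleftrightarrow> nnf \<phi> \<and> nnf \<psi>"
| "nnf (And \<phi> \<psi>) \<longleftrightarrow> nnf \<phi> \<and> nnf \<psi>"
| "nnf (X \<phi>) \<longleftrightarrow> nnf \<phi>"
| "nnf (U \<phi> \<psi>) \<longleftrightarrow> nnf \<phi> \<and> nnf \<psi>"
| "nnf (R \<phi> \<psi>) \<longleftrightarrow> nnf \<phi> \<and> nnf \<psi>"
| "nnf (ExP x \<phi>) \<longleftrightarrow> nnf \<phi>"
| "nnf (AllP x \<phi>) \<longleftrightarrow> nnf \<phi>"

primrec num_ex :: "hyperctl \<Rightarrow> nat" where
  "num_ex (Atom a x) = 0"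
| "num_ex (Neg \<phi>) = num_ex \<phi>"
| "num_ex (Or \<phi> \<psi>) = num_ex \<phi> + num_ex \<psi>"
| "num_ex (And \<phi> \<psi>) = num_ex \<phi> + num_ex \<psi>"
| "num_ex (X \<phi>) = num_ex \<phi>"
| "num_ex (U \<phi> \<psi>) = num_ex \<phi> + num_ex \<psi>"
| "num_ex (R \<phi> \<psi>) = num_ex \<phi> + num_ex \<psi>"
| "num_ex (ExP x \<phi>) = Suc (num_ex \<phi>)"
| "num_ex (AllP x \<phi>) = num_ex \<phi>"

primrec num_all :: "hyperctl \<Rightarrow> nat" where
  "num_all (Atom a x) = 0"
| "num_all (Neg \<phi>) = num_all \<phi>"
| "num_all (Or \<phi> \<psi>) = num_all \<phi> + num_all \<psi>"
| "num_all (And \<phi> \<psi>) = num_all \<phi> + num_all \<psi>"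
| "num_all (X \<phi>) = num_all \<phi>"
| "num_all (U \<phi> \<psi>) = num_all \<phi> + num_all \<psi>"
| "num_all (R \<phi> \<psi>) = num_all \<phi> + num_all \<psi>"
| "num_all (ExP x \<phi>) = num_all \<phi>"
| "num_all (AllP x \<phi>) = Suc (num_all \<phi>)"

primrec subformulas :: "hyperctl \<Rightarrow> hyperctl set" where
  "subformulas (Atom a x) = {Atom a x}"
| "subformulas (Neg \<phi>) = insert (Neg \<phi>) (subformulas \<phi>)"
| "subformulas (Or \<phi> \<psi>) = insert (Or \<phi> \<psi>) (subformulas \<phi> \<union> subformulas \<psi>)"
| "subformulas (And \<phi> \<psi>) = insert (And \<phi> \<psi>) (subformulas \<phi> \<union> subformulas \<psi>)"
| "subformulas (X \<phi>) = insert (X \<phi>) (subformulas \<phi>)"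
| "subformulas (U \<phi> \<psi>) = insert (U \<phi> \<psi>) (subformulas \<phi> \<union> subformulas \<psi>)"
| "subformulas (R \<phi> \<psi>) = insert (R \<phi> \<psi>) (subformulas \<phi> \<union> subformulas \<psi>)"
| "subformulas (ExP x \<phi>) = insert (ExP x \<phi>) (subformulas \<phi>)"
| "subformulas (AllP x \<phi>) = insert (AllP x \<phi>) (subformulas \<phi>)"

definition forall_exists :: "hyperctl \<Rightarrow> bool" where
  "forall_exists \<phi> \<longleftrightarrow>
     free_vars \<phi> = {} \<and> nnf \<phi> \<and> num_all \<phi> = 1 \<and> num_ex \<phi> = 1 \<and>
     (\<exists>x \<psi>. AllP x \<psi> \<in> subformulas \<phi> \<and> num_ex \<psi> = 1)"


section \<open>Algorithms\<close>

text \<open>Partial recursive functions, with \<open>Min\<close> being unbounded minimisation.\<close>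

datatype recf =
    Zero
  | Succ
  | Proj nat
  | Comp recf "recf list"
  | PrimRec recf recf
  | Min recf

inductive rec_eval :: "recf \<Rightarrow> nat list \<Rightarrow> nat \<Rightarrow> bool" where
  zero: "rec_eval Zero xs 0"
| succ: "rec_eval Succ [x] (Suc x)"
| proj: "k < length xs \<Longrightarrow> rec_eval (Proj k) xs (xs ! k)"
| comp: "length ys = length gs \<Longrightarrow> (\<forall>k<length gs. rec_eval (gs ! k) xs (ys ! k)) \<Longrightarrow>
    rec_eval f ys z \<Longrightarrow> rec_eval (Comp f gs) xs z"
| prim_0: "rec_eval f xs y \<Longrightarrow> rec_eval (PrimRec f g) (0 # xs) y"
| prim_Suc: "rec_eval (PrimRec f g) (n # xs) y \<Longrightarrow> rec_eval g (n # y # xs) z \<Longrightarrow>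
    rec_eval (PrimRec f g) (Suc n # xs) z"
| min: "rec_eval f (n # xs) 0 \<Longrightarrow> (\<forall>m<n. \<exists>y. rec_eval f (m # xs) (Suc y)) \<Longrightarrow>
    rec_eval (Min f) xs n"

lemma rec_eval_deterministic: "rec_eval f xs y \<Longrightarrow> rec_eval f xs z \<Longrightarrow> z = y"
proof (induction arbitrary: z rule: rec_eval.induct)
  case (zero xs)
  then show ?case by (rule rec_eval.cases) simp_all
next
  case (succ x)
  then show ?case by (rule rec_eval.cases) simp_all
next
  case (proj k xs)
  from proj.prems show ?case by (rule rec_eval.cases) simp_all
next
  case (comp ys gs xs f y)
  from comp.prems obtain zs where zs: "length zs = length gs"
    "\<forall>k<length gs. rec_eval (gs ! k) xs (zs ! k)" "rec_eval f zs z"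
    by (rule rec_eval.cases) simp_all
  have "zs = ys"
  proof (rule nth_equalityI)
    show "length zs = length ys" using comp.hyps zs(1) by simp
    show "zs ! k = ys ! k" if "k < length zs" for k
      using comp.IH(1) zs(1,2) that by simp
  qed
  then show ?case
    using comp.IH(2) zs(3) by simp
next
  case (prim_0 f xs y g)
  from prim_0.prems have "rec_eval f xs z"
    by (rule rec_eval.cases) simp_all
  then show ?case by (rule prim_0.IH)
next
  case (prim_Suc f g n xs y w)
  from prim_Suc.prems obtain v where
    v: "rec_eval (PrimRec f g) (n # xs) v" "rec_eval g (n # v # xs) z"
    by (rule rec_eval.cases) simp_all
  have "v = y" using v(1) by (rule prim_Suc.IH(1))
  then show ?case using v(2) prim_Suc.IH(2) by simp
next
  case (min f n xs)
  from min.prems have z: "rec_eval f (z # xs) 0 \<and> (\<forall>m<z. \<exists>y. rec_eval f (m # xs) (Suc y))"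
    by (rule rec_eval.cases) simp_all
  have "\<not> z < n"
  proof
    assume "z < n"
    then obtain y where "\<forall>w. rec_eval f (z # xs) w \<longrightarrow> w = Suc y"
      using min.IH(2) by blast
    then show False using z by blast
  qed
  moreover have "\<not> n < z"
  proof
    assume "n < z"
    then obtain y where "rec_eval f (n # xs) (Suc y)" using z by blast
    then have "Suc y = 0" by (rule min.IH(1))
    then show False by simp
  qed
  ultimately show ?case by simp
qed

primrec encode :: "hyperctl \<Rightarrow> nat" where
  "encode (Atom a x) = prod_encode (0, prod_encode (a, x))"
| "encode (Neg \<phi>) = prod_encode (1, encode \<phi>)"
| "encode (Or \<phi> \<psi>) = prod_encode (2, prod_encode (encode \<phi>, encode \<psi>))"
| "encode (And \<phi> \<psi>) = prod_encode (3, prod_encode (encode \<phi>, encode \<psi>))"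
| "encode (X \<phi>) = prod_encode (4, encode \<phi>)"
| "encode (U \<phi> \<psi>) = prod_encode (5, prod_encode (encode \<phi>, encode \<psi>))"
| "encode (R \<phi> \<psi>) = prod_encode (6, prod_encode (encode \<phi>, encode \<psi>))"
| "encode (ExP x \<phi>) = prod_encode (7, prod_encode (x, encode \<phi>))"
| "encode (AllP x \<phi>) = prod_encode (8, prod_encode (x, encode \<phi>))"

lemma encode_inject: "encode \<phi> = encode \<psi> \<longleftrightarrow> \<phi> = \<psi>"
proof
  show "encode \<phi> = encode \<psi> \<Longrightarrow> \<phi> = \<psi>"
  proof (induction \<phi> arbitrary: \<psi>)
    case (Atom a x)
    then show ?case by (cases \<psi>) simp_all
  next
    case (Neg \<phi>)
    then show ?case by (cases \<psi>) simp_all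
  next
    case (Or \<phi>1 \<phi>2)
    then show ?case by (cases \<psi>) simp_all
  next
    case (And \<phi>1 \<phi>2)
    then show ?case by (cases \<psi>) simp_all
  next
    case (X \<phi>)
    then show ?case by (cases \<psi>) simp_all
  next
    case (U \<phi>1 \<phi>2)
    then show ?case by (cases \<psi>) simp_all
  next
    case (R \<phi>1 \<phi>2)
    then show ?case by (cases \<psi>) simp_all
  next
    case (ExP x \<phi>)
    then show ?case by (cases \<psi>) simp_all
  next
    case (AllP x \<phi>)
    then show ?case by (cases \<psi>) simp_all
  qed
qed simp

text \<open>A decision procedure only has to behave correctly on the admissible inputs \<open>I\<close>.\<close>

definition decides :: "recf \<Rightarrow> hyperctl set \<Rightarrow> (hyperctl \<Rightarrow> bool) \<Rightarrow> bool" where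
  "decides f I Q \<longleftrightarrow> (\<forall>\<phi>\<in>I. rec_eval f [encode \<phi>] (if Q \<phi> then 1 else 0))"

end

theory Submission
  imports Defs "HOL-Library.Countable_Set"
begin

text \<open>A path stores a tuple of natural numbers in unary. If a formula demands \<open>\<exists>\<pi>'\<close> at each of the first
  \<open>K\<close> positions of every path \<open>\<pi>\<close>, and all data come after these positions, then a single quantifier
  \<open>\<exists>\<pi>'\<close> provides \<open>K\<close> independent witnesses. Such formulas can say that every tuple is a judgement
  about the value of some recursive function whose \<open>K\<close> premises are also present. The premises
  are about smaller functions or smaller arguments, so every judgement in a model is true;
  conversely, all true judgements form a countable set of paths, which is a model. Hence for every
  recursive function \<open>F\<close> there is a formula \<open>\<chi>\<close> that is satisfiable with input \<open>n\<close> iff \<open>F n = 0\<close>.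
  If \<open>F c\<close> runs a decision procedure on the formula with code \<open>c\<close> and input \<open>c\<close>, then the code of
  \<open>\<chi>\<close> is a counterexample to the procedure.\<close>


section \<open>Quantifier-free formulas\<close>

definition Truth :: hyperctl where
  "Truth = Or (Atom 0 0) (Neg (Atom 0 0))"

definition Falsity :: hyperctl where
  "Falsity = And (Atom 0 0) (Neg (Atom 0 0))"

definition conj_list :: "hyperctl list \<Rightarrow> hyperctl" where
  "conj_list \<phi>s = foldr And \<phi>s Truth"

definition disj_list :: "hyperctl list \<Rightarrow> hyperctl" where
  "disj_list \<phi>s = foldr Or \<phi>s Falsity"

lemma sem_Falsity [simp]: "\<not> sem S r L P e i Falsity"
  by (auto simp: Falsity_def)

lemma sem_conj_list [simp]: "sem S r L P e i (conj_list \<phi>s) \<longleftrightarrow> (\<forall>\<phi>\<in>set \<phi>s. sem S r L P e i \<phi>)"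
  unfolding conj_list_def by (induction \<phi>s) (auto simp: Truth_def)

lemma sem_disj_list [simp]: "sem S r L P e i (disj_list \<phi>s) \<longleftrightarrow> (\<exists>\<phi>\<in>set \<phi>s. sem S r L P e i \<phi>)"
  unfolding disj_list_def by (induction \<phi>s) simp_all

lemma sem_X_funpow [simp]: "sem S r L P e i ((X ^^ k) \<phi>) \<longleftrightarrow> sem S r L P e (i + k) \<phi>"
  by (induction k arbitrary: i) simp_all

definition plain :: "pvar set \<Rightarrow> hyperctl \<Rightarrow> bool" where
  "plain A \<phi> \<longleftrightarrow> free_vars \<phi> \<subseteq> A \<and> nnf \<phi> \<and> num_all \<phi> = 0 \<and> num_ex \<phi> = 0"

lemma plain_simps [simp]:
  "plain A (Atom a x) \<longleftrightarrow> x \<in> A"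
  "plain A (Neg (Atom a x)) \<longleftrightarrow> x \<in> A"
  "plain A (Or \<phi> \<psi>) \<longleftrightarrow> plain A \<phi> \<and> plain A \<psi>"
  "plain A (And \<phi> \<psi>) \<longleftrightarrow> plain A \<phi> \<and> plain A \<psi>"
  "plain A (X \<phi>) \<longleftrightarrow> plain A \<phi>"
  "plain A (U \<phi> \<psi>) \<longleftrightarrow> plain A \<phi> \<and> plain A \<psi>"
  by (auto simp: plain_def)

lemma plain_conj_list [simp]: "0 \<in> A \<Longrightarrow> plain A (conj_list \<phi>s) \<longleftrightarrow> (\<forall>\<phi>\<in>set \<phi>s. plain A \<phi>)"
  unfolding conj_list_def by (induction \<phi>s) (simp_all add: Truth_def)

lemma plain_disj_list [simp]: "0 \<in> A \<Longrightarrow> plain A (disj_list \<phi>s) \<longleftrightarrow> (\<forall>\<phi>\<in>set \<phi>s. plain A \<phi>)"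
  unfolding disj_list_def by (induction \<phi>s) (simp_all add: Falsity_def)

lemma plain_X_funpow [simp]: "plain A ((X ^^ k) \<phi>) \<longleftrightarrow> plain A \<phi>"
  by (induction k) simp_all


section \<open>Numbers on a path\<close>

definition first_at :: "(nat \<Rightarrow> bool) \<Rightarrow> nat \<Rightarrow> nat \<Rightarrow> bool" where
  "first_at p i j \<longleftrightarrow> p (i + j) \<and> (\<forall>k<j. \<not> p (i + k))"

lemma first_at_Least: "first_at p i j \<Longrightarrow> (LEAST k. p (i + k)) = j"
  unfolding first_at_def by (rule Least_equality) (auto simp: not_less[symmetric])

lemma first_at_unique: "first_at p i j \<Longrightarrow> first_at p i k \<Longrightarrow> j = k"
  using first_at_Least by metis

lemma first_at_0: "first_at p i 0 \<longleftrightarrow> p i"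
  by (simp add: first_at_def)

lemma first_at_Suc: "first_at p i (Suc j) \<longleftrightarrow> \<not> p i \<and> first_at p (Suc i) j"
  by (auto simp: first_at_def less_Suc_eq_0_disj)

text \<open>One until compares two unary numbers: if both marks hold at \<open>j\<close> and neither
  holds earlier, then \<open>j\<close> is the first occurrence of each.\<close>

lemma sem_U_first:
  "(\<exists>j\<ge>i. (p j \<and> q j) \<and> (\<forall>k. i \<le> k \<and> k < j \<longrightarrow> \<not> p k \<and> \<not> q k)) \<longleftrightarrow>
   (\<exists>j. first_at p i j \<and> first_at q i j)" (is "?l = ?r")
proof
  assume ?l
  then obtain j where j: "i \<le> j" "p j" "q j" "\<forall>k. i \<le> k \<and> k < j \<longrightarrow> \<not> p k \<and> \<not> q k" by blast
  then have "first_at p i (j - i) \<and> first_at q i (j - i)"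
    by (auto simp: first_at_def)
  then show ?r by blast
next
  assume ?r
  then obtain j where j: "first_at p i j" "first_at q i j" by blast
  have "\<not> p k \<and> \<not> q k" if "i \<le> k" "k < i + j" for k
    using j that unfolding first_at_def by (metis add_less_cancel_left le_iff_add)
  then show ?l
    using j by (intro exI[of _ "i + j"]) (auto simp: first_at_def)
qed

fun number :: "ap \<Rightarrow> pvar \<Rightarrow> nat \<Rightarrow> hyperctl" where
  "number a x 0 = Atom a x"
| "number a x (Suc c) = And (Neg (Atom a x)) (X (number a x c))"

lemma plain_number [simp]: "plain A (number a x c) \<longleftrightarrow> x \<in> A"
  by (induction c) auto

lemma sem_number:
  assumes "P x = Some p"
  shows "sem S r L P e i (number a x c) \<longleftrightarrow> first_at (\<lambda>k. a \<in> L (p k)) i c"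
  using assms by (induction c arbitrary: i) (simp_all add: first_at_0 first_at_Suc)

text \<open>The number in a track is the offset of the first occurrence of its proposition. Constraints
  relate the numbers on a current path, bound to variable 0, with those on a next path, bound to
  variable 1; their formulas are true only if the numbers involved exist.\<close>

datatype slot = Cur nat | Nxt nat

datatype constraint = Eq slot slot | SucOf slot slot | Const slot nat

fun slot_val :: "(nat \<Rightarrow> nat) \<Rightarrow> (nat \<Rightarrow> nat) \<Rightarrow> slot \<Rightarrow> nat" where
  "slot_val v w (Cur a) = v a"
| "slot_val v w (Nxt a) = w a"

fun holds :: "(nat \<Rightarrow> nat) \<Rightarrow> (nat \<Rightarrow> nat) \<Rightarrow> constraint \<Rightarrow> bool" where
  "holds v w (Eq s t) \<longleftrightarrow> slot_val v w s = slot_val v w t"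
| "holds v w (SucOf s t) \<longleftrightarrow> slot_val v w s = Suc (slot_val v w t)"
| "holds v w (Const s c) \<longleftrightarrow> slot_val v w s = c"

text \<open>Odd propositions are tracks and positive even ones are ticks, which leaves 0 free for
  the input.\<close>

definition track :: "nat \<Rightarrow> ap" where
  "track a = 2 * a + 1"

definition tick :: "nat \<Rightarrow> ap" where
  "tick t = 2 * t + 2"

lemma ap_distinct [simp]:
  "track a = track b \<longleftrightarrow> a = b" "tick s = tick t \<longleftrightarrow> s = t"
  "track a \<noteq> tick t" "tick t \<noteq> track a" "track a \<noteq> 0" "tick t \<noteq> 0"
  unfolding track_def tick_def by presburger+

fun slot_ap :: "slot \<Rightarrow> ap" where
  "slot_ap (Cur a) = track a"
| "slot_ap (Nxt a) = track a"

fun slot_pvar :: "slot \<Rightarrow> pvar" where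
  "slot_pvar (Cur a) = 0"
| "slot_pvar (Nxt a) = 1"

definition slot_atom :: "slot \<Rightarrow> hyperctl" where
  "slot_atom s = Atom (slot_ap s) (slot_pvar s)"

text \<open>In \<open>SucOf\<close>, the mark of \<open>s\<close> is read one position ahead of that
  of \<open>t\<close>; the outer negation rules out that \<open>s\<close> already occurs at offset
  0.\<close>

fun formula :: "constraint \<Rightarrow> hyperctl" where
  "formula (Eq s t) =
    U (And (Neg (slot_atom s)) (Neg (slot_atom t))) (And (slot_atom s) (slot_atom t))"
| "formula (SucOf s t) = And (Neg (slot_atom s))
    (U (And (X (Neg (slot_atom s))) (Neg (slot_atom t))) (And (X (slot_atom s)) (slot_atom t)))"
| "formula (Const s c) = number (slot_ap s) (slot_pvar s) c"

lemma plain_formula [simp]: "plain {0, 1} (formula c)"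
proof -
  have "slot_pvar s \<in> {0, 1}" for s by (cases s) auto
  then show ?thesis by (cases c) (auto simp: slot_atom_def)
qed

context
  fixes S :: "'n set" and r :: "'n rel" and L :: "'n \<Rightarrow> ap set"
    and P :: "pvar \<rightharpoonup> (nat \<Rightarrow> 'n)" and p q :: "nat \<Rightarrow> 'n"
  assumes P: "P 0 = Some p" "P 1 = Some q"
begin

definition marked :: "slot \<Rightarrow> nat \<Rightarrow> bool" where
  "marked s k \<longleftrightarrow> slot_ap s \<in> L ((case s of Cur _ \<Rightarrow> p | Nxt _ \<Rightarrow> q) k)"

lemma sem_slot_atom: "sem S r L P e k (slot_atom s) \<longleftrightarrow> marked s k"
  using P by (cases s) (simp_all add: slot_atom_def marked_def)

lemma sem_formula:
  "sem S r L P e i (formula (Eq s t)) \<longleftrightarrow> (\<exists>j. first_at (marked s) i j \<and> first_at (marked t) i j)"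
  "sem S r L P e i (formula (SucOf s t)) \<longleftrightarrow>
     (\<exists>j. first_at (marked s) i (Suc j) \<and> first_at (marked t) i j)"
  "sem S r L P e i (formula (Const s c)) \<longleftrightarrow> first_at (marked s) i c"
proof -
  show "sem S r L P e i (formula (Eq s t)) \<longleftrightarrow>
      (\<exists>j. first_at (marked s) i j \<and> first_at (marked t) i j)"
    unfolding sem_U_first[symmetric] by (simp add: sem_slot_atom)
  have "first_at (\<lambda>k. marked s (Suc k)) i j \<longleftrightarrow> first_at (marked s) (Suc i) j" for j
    by (simp add: first_at_def)
  then show "sem S r L P e i (formula (SucOf s t)) \<longleftrightarrow>
      (\<exists>j. first_at (marked s) i (Suc j) \<and> first_at (marked t) i j)"
    using sem_U_first[of i "\<lambda>k. marked s (Suc k)" "marked t"]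
    by (simp add: sem_slot_atom first_at_Suc)
  show "sem S r L P e i (formula (Const s c)) \<longleftrightarrow> first_at (marked s) i c"
    using P by (cases s) (simp_all add: sem_number marked_def first_at_def)
qed

text \<open>In an arbitrary model a mark may be repeated or missing. \<open>LEAST\<close> still
  yields a total valuation, and a true formula guarantees that the marks it mentions exist.\<close>

lemma formula_sound:
  assumes "sem S r L P e i (formula c)"
  shows "holds (\<lambda>a. LEAST j. track a \<in> L (p (i + j))) (\<lambda>a. LEAST j. track a \<in> L (q (i + j))) c"
    (is "holds ?v ?w c")
proof -
  have "slot_val ?v ?w s = j" if "first_at (marked s) i j" for s j
    using first_at_Least[OF that] by (cases s) (simp_all add: marked_def)
  then show ?thesis
    using assms by (cases c) (auto simp: sem_formula simp del: formula.simps)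
qed

lemma formula_complete:
  assumes "\<And>a j. track a \<in> L (p (i + j)) \<longleftrightarrow> j = v a" "\<And>a j. track a \<in> L (q (i + j)) \<longleftrightarrow> j = w a"
    and "holds v w c"
  shows "sem S r L P e i (formula c)"
proof -
  have "first_at (marked s) i (slot_val v w s)" for s
    using assms(1,2) by (cases s) (simp_all add: marked_def first_at_def)
  then show ?thesis
    using assms(3) by (cases c) (auto simp: sem_formula simp del: formula.simps, metis+)
qed

end


section \<open>Constraint systems as formulas\<close>

text \<open>A constraint system is a list of obligations, each in disjunctive normal form.\<close>

definition closed_under :: "constraint list list list \<Rightarrow> (nat \<Rightarrow> nat) set \<Rightarrow> bool" where
  "closed_under \<Sigma> T \<longleftrightarrow>
     (\<forall>v\<in>T. \<forall>ob\<in>set \<Sigma>. \<exists>w\<in>T. \<exists>cs\<in>set ob. \<forall>c\<in>set cs. holds v w c)"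

text \<open>The first \<open>K\<close> positions, marked by ticks, are reserved for choosing next paths, so the numbers
  on a path are counted from position \<open>K\<close>. Only the input, marked by proposition 0, is counted from
  position 0, because it must be written without knowing \<open>K\<close>; it is copied to track 0.\<close>

definition input_track :: "nat \<Rightarrow> hyperctl" where
  "input_track K = U (And (Neg (Atom 0 0)) ((X ^^ K) (Neg (Atom (track 0) 0))))
     (And (Atom 0 0) ((X ^^ K) (Atom (track 0) 0)))"

definition ticks :: "nat \<Rightarrow> hyperctl" where
  "ticks K = conj_list (map (\<lambda>t. (X ^^ t) (Atom (tick t) 0)) [0..<K])"

definition obligation :: "nat \<Rightarrow> constraint list list \<Rightarrow> hyperctl" where
  "obligation k ob = (X ^^ k) (disj_list (map (\<lambda>cs. conj_list (map formula cs)) ob))"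

text \<open>Obligation \<open>t\<close> is triggered at position \<open>t\<close>; the shift by
  \<open>length \<Sigma> - t\<close> leads to position \<open>length \<Sigma>\<close>, where the
  numbers start.\<close>

definition obligations :: "constraint list list list \<Rightarrow> hyperctl" where
  "obligations \<Sigma> = conj_list (map
     (\<lambda>t. Or (Neg (Atom (tick t) 0)) (obligation (length \<Sigma> - t) (\<Sigma> ! t))) [0..<length \<Sigma>])"

text \<open>\<open>R Falsity\<close> means always. The quantifier below it is evaluated afresh at
  every position, so each tick may choose a different next path.\<close>

definition system :: "constraint list list list \<Rightarrow> hyperctl" where
  "system \<Sigma> = And (input_track (length \<Sigma>))
     (And (ticks (length \<Sigma>)) (R Falsity (ExP 1 (obligations \<Sigma>))))"

definition with_input :: "hyperctl \<Rightarrow> nat \<Rightarrow> hyperctl" where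
  "with_input \<chi> n = AllP 0 (And (number 0 0 n) \<chi>)"

lemma forall_exists_with_input: "forall_exists (with_input (system \<Sigma>) n)"
proof -
  have "plain {0} (input_track K)" "plain {0} (ticks K)" "plain {0, 1} (obligations \<Sigma>)"
    "plain {0} (number 0 0 n)" for K
    by (auto simp: input_track_def ticks_def obligations_def obligation_def simp flip: One_nat_def)
  then have "free_vars (with_input (system \<Sigma>) n) = {}" "nnf (with_input (system \<Sigma>) n)"
    "num_all (with_input (system \<Sigma>) n) = 1" "num_ex (with_input (system \<Sigma>) n) = 1"
    "num_ex (And (number 0 0 n) (system \<Sigma>)) = 1"
    unfolding with_input_def system_def by (auto simp: plain_def Falsity_def)
  moreover have "AllP 0 (And (number 0 0 n) (system \<Sigma>)) \<in> subformulas (with_input (system \<Sigma>) n)"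
    by (simp add: with_input_def)
  ultimately show ?thesis
    unfolding forall_exists_def by blast
qed

lemma sem_obligation:
  "sem S r L P e i (obligation k ob) \<longleftrightarrow>
     (\<exists>cs\<in>set ob. \<forall>c\<in>set cs. sem S r L P e (i + k) (formula c))"
  by (auto simp: obligation_def)

lemma sem_obligations:
  assumes "P 0 = Some p"
  shows "sem S r L P e i (obligations \<Sigma>) \<longleftrightarrow> (\<forall>t<length \<Sigma>. tick t \<in> L (p i) \<longrightarrow>
    (\<exists>cs\<in>set (\<Sigma> ! t). \<forall>c\<in>set cs. sem S r L P e (i + (length \<Sigma> - t)) (formula c)))"
  using assms by (auto simp: obligations_def sem_obligation)

lemma sem_input_track:
  assumes "P 0 = Some p"
  shows "sem S r L P e 0 (input_track K) \<longleftrightarrow> (\<exists>j. first_at (\<lambda>k. 0 \<in> L (p k)) 0 j \<and>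
    first_at (\<lambda>k. track 0 \<in> L (p (k + K))) 0 j)"
  unfolding sem_U_first[symmetric] using assms by (simp add: input_track_def)

lemma sem_ticks:
  assumes "P 0 = Some p"
  shows "sem S r L P e 0 (ticks K) \<longleftrightarrow> (\<forall>t<K. tick t \<in> L (p t))"
  using assms by (auto simp: ticks_def)

lemma sem_system:
  assumes "P 0 = Some p"
  shows "sem S r L P e 0 (system \<Sigma>) \<longleftrightarrow>
    (\<exists>j. first_at (\<lambda>k. 0 \<in> L (p k)) 0 j \<and> first_at (\<lambda>k. track 0 \<in> L (p (k + length \<Sigma>))) 0 j) \<and>
    (\<forall>t<length \<Sigma>. tick t \<in> L (p t)) \<and>
    (\<forall>i. \<exists>q\<in>Paths S r. agree e i q \<and> (\<forall>t<length \<Sigma>. tick t \<in> L (p i) \<longrightarrow>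
      (\<exists>cs\<in>set (\<Sigma> ! t). \<forall>c\<in>set cs.
        sem S r L (P(1 \<mapsto> q)) (Some q) (i + (length \<Sigma> - t)) (formula c))))"
  using assms by (simp add: system_def sem_input_track sem_ticks sem_obligations)

lemma models_with_input:
  "models S r L (with_input (system \<Sigma>) n) \<longleftrightarrow> (\<forall>p\<in>Paths S r.
     first_at (\<lambda>k. 0 \<in> L (p k)) 0 n \<and> first_at (\<lambda>k. track 0 \<in> L (p (k + length \<Sigma>))) 0 n \<and>
     (\<forall>t<length \<Sigma>. tick t \<in> L (p t)) \<and>
     (\<forall>i. \<exists>q\<in>Paths S r. agree (Some p) i q \<and> (\<forall>t<length \<Sigma>. tick t \<in> L (p i) \<longrightarrow>
       (\<exists>cs\<in>set (\<Sigma> ! t). \<forall>c\<in>set cs.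
         sem S r L [0 \<mapsto> p, 1 \<mapsto> q] (Some q) (i + (length \<Sigma> - t)) (formula c)))))"
proof -
  \<comment> \<open>The offset found by \<open>input_track\<close> is the first mark of proposition
    0, which \<open>number 0 0 n\<close> fixes to \<open>n\<close>.\<close>
  have "(\<exists>j. first_at A i j \<and> B j) \<longleftrightarrow> B n" if "first_at A i n" for A B i
    using that first_at_unique by blast
  then show ?thesis
    by (simp add: models_def with_input_def sem_number sem_system cong: conj_cong)
qed

text \<open>The set consists of all paths read as valuations from position \<open>K\<close> on;
  obligation \<open>t\<close> is met by the path chosen at position \<open>t\<close>.\<close>

lemma closed_under_of_model:
  assumes "models S r L (with_input (system \<Sigma>) n)" and "Paths S r \<noteq> {}"
  shows "\<exists>T. T \<noteq> {} \<and> (\<forall>v\<in>T. v 0 = n) \<and> closed_under \<Sigma> T"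
proof -
  define K where "K = length \<Sigma>"
  define val where "val p = (\<lambda>a. LEAST j. track a \<in> L (p (K + j)))" for p
  note M = assms(1)[unfolded models_with_input, folded K_def, rule_format]
  have "val p 0 = n" if "p \<in> Paths S r" for p
    using M[OF that] first_at_Least[of "\<lambda>k. track 0 \<in> L (p (k + K))" 0 n]
    by (simp add: val_def add.commute)
  moreover have "closed_under \<Sigma> (val ` Paths S r)"
    unfolding closed_under_def
  proof (intro ballI)
    fix v ob assume "v \<in> val ` Paths S r" "ob \<in> set \<Sigma>"
    then obtain p t where pt: "p \<in> Paths S r" "v = val p" "t < K" "ob = \<Sigma> ! t"
      by (auto simp: in_set_conv_nth K_def)
    then obtain q cs where q: "q \<in> Paths S r" "cs \<in> set ob"
      "\<And>c. c \<in> set cs \<Longrightarrow> sem S r L [0 \<mapsto> p, 1 \<mapsto> q] (Some q) (t + (K - t)) (formula c)"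
      using M[OF pt(1)] by metis
    have "holds v (val q) c" if "c \<in> set cs" for c
      using formula_sound[OF _ _ q(3)[OF that]] pt(2,3) by (simp add: val_def)
    then show "\<exists>w\<in>val ` Paths S r. \<exists>cs\<in>set ob. \<forall>c\<in>set cs. holds v w c"
      using q(1,2) by blast
  qed
  ultimately show ?thesis
    using assms(2) by (intro exI[of _ "val ` Paths S r"]) blast
qed


section \<open>Trees with a common initial segment\<close>

text \<open>Countably many branches that share exactly their first \<open>K\<close> nodes; \<open>h\<close> embeds the nodes
  into the given type.\<close>

locale broom =
  fixes h :: "nat \<times> nat \<Rightarrow> 'n" and K :: nat
  assumes inj_h: "inj h" and K_pos: "0 < K"
begin

definition node :: "nat \<Rightarrow> nat \<Rightarrow> 'n" where
  "node m i = h (if i < K then 0 else m, i)"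

definition nodes :: "'n set" where
  "nodes = {node m i | m i. True}"

definition order :: "'n rel" where
  "order = {(node m i, node m j) | m i j. i \<le> j}"

lemma node_eq: "node m i = node m' j \<longleftrightarrow> i = j \<and> (K \<le> i \<longrightarrow> m = m')"
  using inj_h by (auto simp: node_def inj_def)

lemma node_order: "(node m i, node m' j) \<in> order \<longleftrightarrow> i \<le> j \<and> (K \<le> i \<longrightarrow> m = m')"
  unfolding order_def by (auto simp: node_eq)

lemma node_strict: "strict_anc order (node m i) (node m' j) \<longleftrightarrow> i < j \<and> (K \<le> i \<longrightarrow> m = m')"
  unfolding strict_anc_def node_order node_eq by auto

lemma strict_nodes: "strict_anc order s t \<Longrightarrow> s \<in> nodes \<and> t \<in> nodes"
  by (auto simp: strict_anc_def order_def nodes_def)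

lemma is_root: "is_root nodes order s \<longleftrightarrow> s = node 0 0"
proof
  assume "is_root nodes order s"
  then have "s \<in> nodes" "(s, node 0 0) \<in> order"
    by (auto simp: is_root_def nodes_def)
  then show "s = node 0 0"
    using K_pos by (auto simp: nodes_def node_order node_eq)
next
  assume "s = node 0 0"
  then show "is_root nodes order s"
    using K_pos by (auto simp: is_root_def nodes_def node_order)
qed

lemma direct_anc: "direct_anc order (node m i) t \<longleftrightarrow> (\<exists>m'. t = node m' (Suc i) \<and> (K \<le> i \<longrightarrow> m = m'))"
proof
  assume t: "direct_anc order (node m i) t"
  then obtain m' j where t_def: "t = node m' j"
    using strict_nodes by (fastforce simp: direct_anc_def nodes_def)
  have ij: "i < j" "K \<le> i \<longrightarrow> m = m'"
    using t by (auto simp: direct_anc_def t_def node_strict)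
  \<comment> \<open>The node of branch \<open>m'\<close> at level \<open>Suc i\<close> would lie
    strictly between \<open>node m i\<close> and \<open>t\<close> unless it is
    \<open>t\<close>.\<close>
  have "strict_anc order (node m i) (node m' (Suc i))"
    using ij by (simp add: node_strict)
  then have "\<not> strict_anc order (node m' (Suc i)) (node m' j)"
    using t by (auto simp: direct_anc_def t_def)
  then have "j = Suc i"
    using ij by (auto simp: node_strict)
  then show "\<exists>m'. t = node m' (Suc i) \<and> (K \<le> i \<longrightarrow> m = m')"
    using t_def ij by blast
next
  assume "\<exists>m'. t = node m' (Suc i) \<and> (K \<le> i \<longrightarrow> m = m')"
  then obtain m' where t: "t = node m' (Suc i)" "K \<le> i \<longrightarrow> m = m'" by blast
  have False if u: "strict_anc order (node m i) u" "strict_anc order u t" for u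
  proof -
    obtain l k where "u = node l k"
      using strict_nodes[OF u(1)] by (auto simp: nodes_def)
    then show False
      using u by (simp add: t node_strict)
  qed
  then show "direct_anc order (node m i) t"
    using t by (auto simp: direct_anc_def node_strict)
qed

lemma is_tree: "is_tree nodes order"
proof -
  have "infinite nodes"
  proof
    assume "finite nodes"
    then have "finite (range (node 0))"
      by (rule rev_finite_subset) (auto simp: nodes_def)
    then show False
      by (auto simp: finite_image_iff inj_def node_eq)
  qed
  moreover have "order \<subseteq> nodes \<times> nodes"
    by (auto simp: order_def nodes_def)
  moreover have "partial_order_on nodes order"
  proof -
    have "refl_on nodes order"
      by (auto simp: refl_on_def nodes_def node_order)
    moreover have "trans order"
    proof (rule transI)
      fix s t u assume "(s, t) \<in> order" "(t, u) \<in> order"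
      then show "(s, u) \<in> order"
        by (auto simp: order_def node_eq)
    qed
    moreover have "antisym order"
      by (rule antisymI) (auto simp: order_def node_eq)
    ultimately show ?thesis
      unfolding partial_order_on_def preorder_on_def
      by (auto simp: order_def nodes_def)
  qed
  moreover have "total_on {t. strict_anc order t s} order" if s: "s \<in> nodes" for s
  proof (rule total_onI)
    fix t u assume tu: "t \<in> {t. strict_anc order t s}" "u \<in> {t. strict_anc order t s}"
    obtain m i m' j l k where "t = node m i" "u = node m' j" "s = node l k"
      using tu strict_nodes s by (fastforce simp: nodes_def)
    then show "(t, u) \<in> order \<or> (u, t) \<in> order"
      using tu by (auto simp: node_strict node_order)
  qed
  ultimately show ?thesis
    unfolding is_tree_def using is_root by blast
qed

text \<open>All branches coincide below level \<open>K\<close>, and from there on a path cannot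
  change its branch, so its node at level \<open>K\<close> determines it.\<close>

lemma Paths: "Paths nodes order = range node"
proof (intro equalityI subsetI)
  fix p assume "p \<in> Paths nodes order"
  then have p: "p 0 = node 0 0" "\<And>i. direct_anc order (p i) (p (Suc i))"
    by (auto simp: Paths_def is_root)
  have ex: "\<exists>m. p i = node m i" for i
  proof (induction i)
    case (Suc i)
    then show ?case
      using p(2)[of i] by (auto simp: direct_anc)
  qed (use p in blast)
  then obtain m where m: "p K = node m K" by blast
  have "p i = node m i" for i
  proof (cases "K \<le> i")
    case True
    then show ?thesis
    proof (induction rule: dec_induct)
      case (step i)
      then show ?case
        using p(2)[of i] by (auto simp: direct_anc)
    qed (fact m)
  next
    case False
    then show ?thesis
      using ex[of i] by (auto simp: node_def)
  qed
  then show "p \<in> range node" by blast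
next
  fix p assume "p \<in> range node"
  then obtain m where "p = node m" by blast
  then show "p \<in> Paths nodes order"
    using K_pos by (auto simp: Paths_def is_root direct_anc node_eq)
qed

end

text \<open>Each valuation becomes one branch of a broom. At a position below \<open>K\<close> every
  branch agrees with the current one, so any of them can be the next path.\<close>

lemma satisfiable_of_closed_under:
  fixes T :: "(nat \<Rightarrow> nat) set"
  assumes "infinite (UNIV :: 'n set)" and "\<Sigma> \<noteq> []"
    and "countable T" "T \<noteq> {}" and input: "\<And>v. v \<in> T \<Longrightarrow> v 0 = n" and closed: "closed_under \<Sigma> T"
  shows "satisfiable TYPE('n) (with_input (system \<Sigma>) n)"
proof -
  obtain g :: "nat \<Rightarrow> 'n" where "inj g"
    using assms(1) infinite_countable_subset by blast
  define h where "h = g \<circ> prod_encode"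
  define K where "K = length \<Sigma>"
  have "inj h"
    unfolding h_def using \<open>inj g\<close> inj_prod_encode by (intro inj_compose) auto
  then interpret broom h K
    using assms(2) by unfold_locales (auto simp: K_def)
  obtain e :: "nat \<Rightarrow> nat \<Rightarrow> nat" where e: "T = range e"
    using assms(3,4) by (metis range_from_nat_into)
  \<comment> \<open>The input mark may fall into the shared segment; this is consistent because all
    valuations have the same input.\<close>
  define L where "L x = (case inv h x of (m, i) \<Rightarrow>
    {b. b = 0 \<and> i = n \<or> (\<exists>t<K. b = tick t \<and> i = t) \<or> (\<exists>a. b = track a \<and> K \<le> i \<and> i = K + e m a)})" for x
  have L: "0 \<in> L (node m i) \<longleftrightarrow> i = n" "tick t \<in> L (node m i) \<longleftrightarrow> i = t \<and> t < K"
    "track a \<in> L (node m i) \<longleftrightarrow> i = K + e m a" for m i t a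
    using \<open>inj h\<close> by (auto simp: L_def node_def)
  have "models nodes order L (with_input (system \<Sigma>) n)"
    unfolding models_with_input
  proof (intro ballI conjI allI impI)
    fix p assume "p \<in> Paths nodes order"
    then obtain m where p: "p = node m" by (auto simp: Paths)
    have "e m 0 = n" using input e by blast
    then show "first_at (\<lambda>k. 0 \<in> L (p k)) 0 n" "first_at (\<lambda>k. track 0 \<in> L (p (k + length \<Sigma>))) 0 n"
      unfolding K_def[symmetric] by (auto simp: p first_at_def L)
    show "tick t \<in> L (p t)" if "t < length \<Sigma>" for t
      using that unfolding K_def[symmetric] by (simp add: p L)
    show "\<exists>q\<in>Paths nodes order. agree (Some p) i q \<and> (\<forall>t<length \<Sigma>. tick t \<in> L (p i) \<longrightarrow>
        (\<exists>cs\<in>set (\<Sigma> ! t). \<forall>c\<in>set cs.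
          sem nodes order L [0 \<mapsto> p, 1 \<mapsto> q] (Some q) (i + (length \<Sigma> - t)) (formula c)))" for i
    proof (cases "i < K")
      case True
      have "\<Sigma> ! i \<in> set \<Sigma>" "e m \<in> T" using True e by (auto simp: K_def)
      then obtain m' cs where cs: "cs \<in> set (\<Sigma> ! i)" "\<And>c. c \<in> set cs \<Longrightarrow> holds (e m) (e m') c"
        using closed e unfolding closed_under_def by blast
      have "sem nodes order L [0 \<mapsto> p, 1 \<mapsto> node m'] (Some (node m')) (i + (K - i)) (formula c)"
        if "c \<in> set cs" for c
        by (rule formula_complete[OF _ _ _ _ cs(2)[OF that], where p = p and q = "node m'"])
          (use True in \<open>simp_all add: p L\<close>)
      moreover have "agree (Some p) i (node m')"
        using True by (simp add: p node_eq)
      ultimately show ?thesis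
        using cs(1) True
        by (intro bexI[of _ "node m'"]) (auto simp: p L Paths simp flip: K_def intro: bexI[of _ cs])
    next
      case False
      \<comment> \<open>No tick holds from position \<open>K\<close> on, so the path itself is a
        witness.\<close>
      then show ?thesis
        by (intro bexI[of _ p]) (auto simp: p L Paths simp flip: K_def)
    qed
  qed
  moreover have "Paths nodes order \<noteq> {}" by (simp add: Paths)
  ultimately show ?thesis
    unfolding satisfiable_def using is_tree by blast
qed


section \<open>Recursive functions\<close>

inductive_cases rec_evalE:
  "rec_eval Zero xs y" "rec_eval Succ xs y" "rec_eval (Proj k) xs y"
  "rec_eval (PrimRec f g) xs y" "rec_eval (Min f) xs y"

lemma rec_eval_proj: "k < length xs \<Longrightarrow> xs ! k = y \<Longrightarrow> rec_eval (Proj k) xs y"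
  using rec_eval.proj by blast

lemma rec_eval_comp1: "rec_eval g xs y \<Longrightarrow> rec_eval f [y] z \<Longrightarrow> rec_eval (Comp f [g]) xs z"
  by (rule rec_eval.comp[where ys = "[y]"]) auto

lemma rec_eval_comp2:
  "rec_eval g xs y \<Longrightarrow> rec_eval h xs z \<Longrightarrow> rec_eval f [y, z] w \<Longrightarrow> rec_eval (Comp f [g, h]) xs w"
  by (rule rec_eval.comp[where ys = "[y, z]"]) (auto simp: less_Suc_eq)

primrec const_recf :: "nat \<Rightarrow> recf" where
  "const_recf 0 = Zero"
| "const_recf (Suc c) = Comp Succ [const_recf c]"

lemma rec_eval_const: "rec_eval (const_recf c) xs c"
  by (induction c) (auto intro: rec_eval.intros rec_eval_comp1)

definition add_recf :: recf where
  "add_recf = PrimRec (Proj 0) (Comp Succ [Proj 1])"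

lemma rec_eval_add: "rec_eval add_recf [m, n] (m + n)"
  unfolding add_recf_def
  by (induction m) (auto intro!: rec_eval.intros rec_eval_proj rec_eval_comp1 prim_Suc)

definition triangle_recf :: recf where
  "triangle_recf = PrimRec Zero (Comp Succ [Comp add_recf [Proj 0, Proj 1]])"

lemma rec_eval_triangle: "rec_eval triangle_recf [m] (triangle m)"
proof (induction m)
  case 0
  then show ?case
    unfolding triangle_recf_def by (auto intro: rec_eval.intros)
next
  case (Suc m)
  have "rec_eval (Comp Succ [Comp add_recf [Proj 0, Proj 1]]) [m, triangle m] (Suc (m + triangle m))"
    by (intro rec_eval_comp1[OF rec_eval_comp2[OF _ _ rec_eval_add]] rec_eval_proj) (auto intro: rec_eval.succ)
  then show ?case
    using Suc unfolding triangle_recf_def by (auto intro: prim_Suc simp: ac_simps)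
qed

text \<open>This computes \<open>prod_encode (m, n)\<close> as
  \<open>triangle (m + n) + m\<close>.\<close>

definition pair_recf :: "recf \<Rightarrow> recf \<Rightarrow> recf" where
  "pair_recf f g = Comp add_recf [Comp triangle_recf [Comp add_recf [f, g]], f]"

lemma rec_eval_pair:
  assumes "rec_eval f xs m" "rec_eval g xs n"
  shows "rec_eval (pair_recf f g) xs (prod_encode (m, n))"
  unfolding pair_recf_def prod_encode_def prod.case
  by (intro rec_eval_comp2[OF _ _ rec_eval_add] rec_eval_comp1[OF _ rec_eval_triangle] assms)


section \<open>Evaluation as a constraint system\<close>

text \<open>Countability supplies \<open>to_nat\<close>, the code by which track 1 names a
  judgement.\<close>

instance recf :: countable by countable_datatype

text \<open>\<open>Ev f m\<close> stands for judgements that \<open>f\<close> has value \<open>y\<close> on \<open>m\<close> arguments, and \<open>Bel f m\<close> for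
  judgements that \<open>f\<close> is defined and positive on all \<open>k # xs\<close> with \<open>k < n\<close>, where \<open>n # xs\<close> are the
  \<open>Suc m\<close> arguments and the value is ignored. \<open>Bel\<close> unfolds the bounded quantifier in the
  semantics of \<open>Min\<close>.\<close>

datatype judgement = Ev recf nat | Bel recf nat

instance judgement :: countable by countable_datatype

fun arity :: "judgement \<Rightarrow> nat" where
  "arity (Ev f m) = m"
| "arity (Bel f m) = Suc m"

text \<open>A finite list closed under \<open>subgoals\<close>, so that the system stays finite.
  \<open>Bel\<close> and \<open>Ev (PrimRec f g)\<close> are among their own subgoals and are not
  unfolded again.\<close>

fun judgements :: "recf \<Rightarrow> nat \<Rightarrow> judgement list" where
  "judgements Zero m = [Ev Zero m]"
| "judgements Succ m = [Ev Succ m]"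
| "judgements (Proj k) m = [Ev (Proj k) m]"
| "judgements (Comp f gs) m =
    Ev (Comp f gs) m # judgements f (length gs) @ concat (map (\<lambda>g. judgements g m) gs)"
| "judgements (PrimRec f g) m =
    Ev (PrimRec f g) m # judgements f (m - 1) @ judgements g (Suc m)"
| "judgements (Min f) m = Ev (Min f) m # Bel f m # judgements f (Suc m)"

fun subgoals :: "judgement \<Rightarrow> judgement set" where
  "subgoals (Ev (Comp f gs) m) = insert (Ev f (length gs)) ((\<lambda>g. Ev g m) ` set gs)"
| "subgoals (Ev (PrimRec f g) m) = {Ev f (m - 1), Ev (PrimRec f g) m, Ev g (Suc m)}"
| "subgoals (Ev (Min f) m) = {Ev f (Suc m), Bel f m}"
| "subgoals (Bel f m) = {Bel f m, Ev f (Suc m)}"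
| "subgoals (Ev f m) = {}"

lemma judgements_self: "Ev f m \<in> set (judgements f m)"
  by (cases f) auto

lemma subgoals_judgements: "q \<in> set (judgements f m) \<Longrightarrow> subgoals q \<subseteq> set (judgements f m)"
proof (induction f m rule: judgements.induct)
  case (4 f gs m)
  show ?case
  proof (cases "q = Ev (Comp f gs) m")
    case True
    have "Ev g m \<in> (\<Union>g\<in>set gs. set (judgements g m))" if "g \<in> set gs" for g
      using that judgements_self by blast
    then show ?thesis
      using True by (auto simp: judgements_self)
  qed (use 4 in \<open>auto dest: subsetD\<close>)
qed (auto simp: judgements_self dest: subsetD)

text \<open>Alternating odd and even tracks from 3 on leave room for unboundedly many arguments and
  intermediate results.\<close>

definition arg :: "nat \<Rightarrow> nat" where
  "arg i = 2 * i + 3"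

definition aux :: "nat \<Rightarrow> nat" where
  "aux i = 2 * i + 4"

definition valuation :: "nat \<Rightarrow> judgement \<Rightarrow> nat list \<Rightarrow> nat \<Rightarrow> nat list \<Rightarrow> nat \<Rightarrow> nat" where
  "valuation n q xs y zs a = (if a = 0 then n else if a = 1 then to_nat q else if a = 2 then y
     else if odd a then xs ! ((a - 3) div 2) else zs ! ((a - 4) div 2))"

lemma valuation_simps [simp]:
  "valuation n q xs y zs 0 = n" "valuation n q xs y zs (Suc 0) = to_nat q"
  "valuation n q xs y zs 2 = y" "valuation n q xs y zs (arg i) = xs ! i"
  "valuation n q xs y zs (aux i) = zs ! i"
  by (simp_all add: valuation_def arg_def aux_def)

definition args :: "(nat \<Rightarrow> nat) \<Rightarrow> nat \<Rightarrow> nat \<Rightarrow> nat list" where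
  "args v k m = map (\<lambda>i. v (arg (k + i))) [0..<m]"

lemma args_Suc: "args v k (Suc m) = v (arg k) # args v (Suc k) m"
  unfolding args_def by (simp add: upt_conv_Cons map_Suc_upt[symmetric] del: upt_Suc)

definition next_is :: "judgement \<Rightarrow> constraint" where
  "next_is q = Const (Nxt 1) (to_nat q)"

definition copy_args :: "nat \<Rightarrow> nat \<Rightarrow> nat \<Rightarrow> constraint list" where
  "copy_args k l m = map (\<lambda>i. Eq (Nxt (arg (k + i))) (Cur (arg (l + i)))) [0..<m]"

lemma holds_next_is [simp]: "holds v w (next_is q) \<longleftrightarrow> w 1 = to_nat q"
  by (simp add: next_is_def)

lemma holds_copy_args [simp]:
  "(\<forall>c\<in>set (copy_args k l m). holds v w c) \<longleftrightarrow> args w k m = args v l m"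
  by (auto simp: copy_args_def args_def)

text \<open>Tracks: 0 is the input, 1 the code of the judgement, 2 the value.\<close>

fun rules :: "judgement \<Rightarrow> constraint list list list" where
  "rules (Ev Zero m) = [[[Const (Cur 2) 0]]]"
\<comment> \<open>An obligation \<open>[]\<close> has no alternative and cannot be met, which
  excludes judgements with an unsuitable number of arguments.\<close>
| "rules (Ev Succ m) = [if m = 1 then [[SucOf (Cur 2) (Cur (arg 0))]] else []]"
| "rules (Ev (Proj k) m) = [if k < m then [[Eq (Cur 2) (Cur (arg k))]] else []]"
| "rules (Ev (Comp f gs) m) =
    [next_is (Ev f (length gs)) # Eq (Nxt 2) (Cur 2) #
      map (\<lambda>i. Eq (Nxt (arg i)) (Cur (aux i))) [0..<length gs]] #
    map (\<lambda>i. [next_is (Ev (gs ! i) m) # Eq (Nxt 2) (Cur (aux i)) # copy_args 0 0 m]) [0..<length gs]"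
| "rules (Ev (PrimRec f g) 0) = [[]]"
\<comment> \<open>Each obligation distinguishes zero from successor. Track \<open>aux 0\<close> of
  the current path passes the value of the recursive call from one premise to the other.\<close>
| "rules (Ev (PrimRec f g) (Suc m)) =
    [[Const (Cur (arg 0)) 0 # next_is (Ev f m) # Eq (Nxt 2) (Cur 2) # copy_args 0 1 m,
      SucOf (Cur (arg 0)) (Nxt (arg 0)) # next_is (Ev g (Suc (Suc m))) # Eq (Nxt 2) (Cur 2) #
        Eq (Nxt (arg 1)) (Cur (aux 0)) # copy_args (Suc 1) 1 m],
     [[Const (Cur (arg 0)) 0],
      SucOf (Cur (arg 0)) (Nxt (arg 0)) # next_is (Ev (PrimRec f g) (Suc m)) #
        Eq (Nxt 2) (Cur (aux 0)) # copy_args 1 1 m]]"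
| "rules (Ev (Min f) m) =
    [[next_is (Ev f (Suc m)) # Const (Nxt 2) 0 # Eq (Nxt (arg 0)) (Cur 2) # copy_args 1 0 m],
     [next_is (Bel f m) # Eq (Nxt (arg 0)) (Cur 2) # copy_args 1 0 m]]"
| "rules (Bel f m) =
    [[[Const (Cur (arg 0)) 0],
      SucOf (Cur (arg 0)) (Nxt (arg 0)) # next_is (Bel f m) # copy_args 1 1 m],
     [[Const (Cur (arg 0)) 0],
      SucOf (Cur (arg 0)) (Nxt (arg 0)) # next_is (Ev f (Suc m)) # SucOf (Nxt 2) (Cur (aux 0)) #
        copy_args 1 1 m]]"

section \<open>Soundness of the rules\<close>

definition goals_met :: "(nat \<Rightarrow> nat) set \<Rightarrow> judgement \<Rightarrow> (nat \<Rightarrow> nat) \<Rightarrow> bool" where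
  "goals_met T q v \<longleftrightarrow> (\<forall>ob\<in>set (rules q). \<exists>w\<in>T. \<exists>cs\<in>set ob. \<forall>c\<in>set cs. holds v w c)"

text \<open>Induction on the bound \<open>v (arg 0)\<close>: one premise covers its predecessor, the
  other everything below that. The assumption on \<open>f\<close> is later the induction hypothesis
  of \<open>rules_sound\<close>.\<close>

lemma below_sound:
  assumes met: "\<And>q v. v \<in> T \<Longrightarrow> v 1 = to_nat q \<Longrightarrow> goals_met T q v"
    and f: "\<And>v. v \<in> T \<Longrightarrow> v 1 = to_nat (Ev f (Suc m)) \<Longrightarrow> rec_eval f (args v 0 (Suc m)) (v 2)"
    and v: "v \<in> T" "v 1 = to_nat (Bel f m)" and k: "k < v (arg 0)"
  shows "\<exists>y. rec_eval f (k # args v 1 m) (Suc y)"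
  using v k
proof (induction "v (arg 0)" arbitrary: v)
  case (Suc n)
  have *: "goals_met T (Bel f m) v" using met Suc.prems by blast
  show ?case
  proof (cases "k = n")
    case True
    obtain w where w: "w \<in> T" "w 1 = to_nat (Ev f (Suc m))" "v (arg 0) = Suc (w (arg 0))"
      "w 2 = Suc (v (aux 0))" "args w 1 m = args v 1 m"
      using * Suc.hyps(2) unfolding goals_met_def by auto
    then show ?thesis
      using f[of w] True Suc.hyps(2) by (auto simp: args_Suc)
  next
    case False
    obtain w where w: "w \<in> T" "w 1 = to_nat (Bel f m)" "v (arg 0) = Suc (w (arg 0))"
      "args w 1 m = args v 1 m"
      using * Suc.hyps(2) unfolding goals_met_def by auto
    then show ?thesis
      using Suc.hyps(1)[of w] Suc.hyps(2) Suc.prems False by auto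
  qed
qed simp

text \<open>Closure alone would admit circular support. Truth follows because premises are
  well-founded: structural induction on \<open>f\<close>, with inner inductions on the recursion
  argument and on the bound of \<open>Bel\<close>.\<close>

lemma rules_sound:
  assumes met: "\<And>q v. v \<in> T \<Longrightarrow> v 1 = to_nat q \<Longrightarrow> goals_met T q v"
  shows "v \<in> T \<Longrightarrow> v 1 = to_nat (Ev f m) \<Longrightarrow> rec_eval f (args v 0 m) (v 2)"
proof (induction f arbitrary: m v)
  case Zero
  then show ?case
    using met[OF Zero] by (auto simp: goals_met_def intro: rec_eval.intros)
next
  case Succ
  then show ?case
    using met[OF Succ]
    by (auto simp: goals_met_def args_Suc[of _ _ 0, simplified] args_def
        intro: rec_eval.intros split: if_splits)
next
  case (Proj k)
  then show ?case
    using met[OF Proj]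
    by (auto simp: goals_met_def args_def intro!: rec_eval_proj split: if_splits)
next
  case (Comp f gs)
  note * = met[OF Comp.prems, unfolded goals_met_def]
  \<comment> \<open>The premises lie on different paths; they fit together because each is compared
    with the same \<open>aux\<close> tracks of \<open>v\<close>.\<close>
  let ?ys = "map (\<lambda>i. v (aux i)) [0..<length gs]"
  obtain w where w: "w \<in> T" "w 1 = to_nat (Ev f (length gs))" "w 2 = v 2"
    "\<forall>i<length gs. w (arg i) = v (aux i)"
    using * by auto
  then have "args w 0 (length gs) = ?ys"
    by (simp add: args_def)
  then have "rec_eval f ?ys (v 2)"
    using Comp.IH(1)[OF w(1,2)] w(3) by simp
  moreover have "rec_eval (gs ! i) (args v 0 m) (v (aux i))" if i: "i < length gs" for i
  proof -
    obtain w where w: "w \<in> T" "w 1 = to_nat (Ev (gs ! i) m)" "w 2 = v (aux i)"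
      "args w 0 m = args v 0 m"
      using * i by fastforce
    then show ?thesis
      using Comp.IH(2)[OF nth_mem[OF i] w(1,2)] by simp
  qed
  ultimately show ?case
    by (intro rec_eval.comp[where ys = ?ys]) auto
next
  case (PrimRec f g)
  show ?case
  proof (cases m)
    case 0
    then show ?thesis
      using met[OF PrimRec.prems] by (auto simp: goals_met_def)
  next
    case (Suc k)
    have "rec_eval (PrimRec f g) (v (arg 0) # args v 1 k) (v 2)"
      if "v \<in> T" "v 1 = to_nat (Ev (PrimRec f g) (Suc k))" for v
      using that
    proof (induction "v (arg 0)" arbitrary: v)
      case 0
      obtain w where "w \<in> T" "w 1 = to_nat (Ev f k)" "w 2 = v 2" "args w 0 k = args v 1 k"
        using met[OF 0(2,3)] 0(1) unfolding goals_met_def by auto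
      then show ?case
        using PrimRec.IH(1)[of w k] 0(1) by (auto intro: rec_eval.intros)
    next
      case (Suc n)
      obtain w where w: "w \<in> T" "w 1 = to_nat (Ev g (Suc (Suc k)))" "v (arg 0) = Suc (w (arg 0))"
        "w 2 = v 2" "w (arg 1) = v (aux 0)" "args w (Suc 1) k = args v 1 k"
        using met[OF Suc(3,4)] Suc(2) unfolding goals_met_def by auto
      obtain u where u: "u \<in> T" "u 1 = to_nat (Ev (PrimRec f g) (Suc k))"
        "v (arg 0) = Suc (u (arg 0))" "u 2 = v (aux 0)" "args u 1 k = args v 1 k"
        using met[OF Suc(3,4)] Suc(2) unfolding goals_met_def by auto
      have "rec_eval (PrimRec f g) (n # args v 1 k) (v (aux 0))"
        using Suc(1)[of u] Suc(2) u by auto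
      moreover have "rec_eval g (n # v (aux 0) # args v 1 k) (v 2)"
        using PrimRec.IH(2)[OF w(1,2)] w Suc(2) by (simp add: args_Suc)
      ultimately show ?case
        using rec_eval.prim_Suc Suc(2) by metis
    qed
    then show ?thesis
      using PrimRec.prems Suc by (simp add: args_Suc)
  qed
next
  case (Min f)
  note * = met[OF Min.prems, unfolded goals_met_def]
  obtain w where w: "w \<in> T" "w 1 = to_nat (Ev f (Suc m))" "w 2 = 0" "w (arg 0) = v 2"
    "args w 1 m = args v 0 m"
    using * by auto
  obtain u where u: "u \<in> T" "u 1 = to_nat (Bel f m)" "u (arg 0) = v 2" "args u 1 m = args v 0 m"
    using * by auto
  show ?case
  proof (rule rec_eval.min)
    show "rec_eval f (v 2 # args v 0 m) 0"
      using Min.IH[OF w(1,2)] w by (simp add: args_Suc)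
    show "\<forall>k<v 2. \<exists>y. rec_eval f (k # args v 0 m) (Suc y)"
      using below_sound[OF met Min.IH u(1,2)] u by simp
  qed
qed

text \<open>The list \<open>zs\<close> of intermediate results goes into the tracks \<open>aux i\<close>. It may be too short where
  no intermediate results are needed; the junk values of \<open>zs ! i\<close> then do not matter.\<close>

fun derivable :: "judgement \<Rightarrow> nat list \<Rightarrow> nat \<Rightarrow> nat list \<Rightarrow> bool" where
  "derivable (Ev (Comp f gs) m) xs y zs \<longleftrightarrow> length zs = length gs \<and>
     (\<forall>k<length gs. rec_eval (gs ! k) xs (zs ! k)) \<and> rec_eval f zs y"
| "derivable (Ev (PrimRec f g) m) (Suc n # xs) y zs \<longleftrightarrow>
     rec_eval (PrimRec f g) (n # xs) (zs ! 0) \<and> rec_eval g (n # zs ! 0 # xs) y"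
| "derivable (Ev f m) xs y zs \<longleftrightarrow> rec_eval f xs y"
| "derivable (Bel f m) (Suc n # xs) y zs \<longleftrightarrow>
     (\<forall>k<n. \<exists>z. rec_eval f (k # xs) (Suc z)) \<and> rec_eval f (n # xs) (Suc (zs ! 0))"
| "derivable (Bel f m) xs y zs \<longleftrightarrow> True"

lemma derivable_Ev: "rec_eval f xs y \<Longrightarrow> \<exists>zs. derivable (Ev f m) xs y zs"
proof (induction rule: rec_eval.cases)
  case (comp ys gs xs f z)
  then show ?case by auto
next
  case (prim_Suc f g n xs y z)
  then show ?case by (auto intro!: exI[of _ "[y]"])
qed (auto intro!: exI[of _ "[]"] intro: rec_eval.intros)

lemma derivable_Bel:
  assumes "\<forall>k<n. \<exists>z. rec_eval f (k # xs) (Suc z)"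
  shows "\<exists>zs. derivable (Bel f m) (n # xs) y zs"
proof (cases n)
  case (Suc k)
  then obtain z where "rec_eval f (k # xs) (Suc z)" using assms by blast
  then show ?thesis
    using assms Suc by (auto intro!: exI[of _ "[z]"])
qed simp

section \<open>Completeness: true judgements as a solution\<close>

definition solution :: "nat \<Rightarrow> judgement set \<Rightarrow> (nat \<Rightarrow> nat) set" where
  "solution n Q =
     {valuation n q xs y zs | q xs y zs. q \<in> Q \<and> length xs = arity q \<and> derivable q xs y zs}"

lemma countable_solution: "countable (solution n Q)"
proof -
  have "solution n Q \<subseteq> (\<Union>q xs y zs. {valuation n q xs y zs})"
    unfolding solution_def by blast
  then show ?thesis
    by (rule countable_subset) auto
qed

lemma solution_Ev:
  assumes "rec_eval f xs y" "Ev f (length xs) \<in> Q"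
  obtains zs where "valuation n (Ev f (length xs)) xs y zs \<in> solution n Q"
  using assms derivable_Ev[OF assms(1), of "length xs"] by (force simp: solution_def)

lemma solution_Bel:
  assumes "\<forall>k<n. \<exists>z. rec_eval f (k # xs) (Suc z)" "Bel f (length xs) \<in> Q"
  obtains zs where "valuation l (Bel f (length xs)) (n # xs) 0 zs \<in> solution l Q"
  using assms derivable_Bel[OF assms(1), of "length xs" 0] by (force simp: solution_def)

lemma args_valuation [simp]:
  "args (valuation n q xs y zs) k m = map (\<lambda>i. xs ! (k + i)) [0..<m]"
  by (simp add: args_def)


text \<open>Inverting \<open>rec_eval\<close> yields true premises with the intermediate results
  \<open>zs\<close>; their judgements stay in \<open>Q\<close>, so their valuations belong to the
  solution.\<close>

lemma solution_goals_met:
  assumes Q: "\<And>q. q \<in> Q \<Longrightarrow> subgoals q \<subseteq> Q"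
    and q: "q \<in> Q" "length xs = arity q" "derivable q xs y zs"
  shows "goals_met (solution n Q) q (valuation n q xs y zs)"
proof -
  \<comment> \<open>Alternatives without a premise still need some next valuation; the current one
    serves.\<close>
  have self: "valuation n q xs y zs \<in> solution n Q"
    using q by (auto simp: solution_def)
  show ?thesis
  proof (cases q)
    case (Ev f m)
    show ?thesis
    proof (cases f)
      case Zero
      then show ?thesis
        using q Ev self by (auto simp: goals_met_def elim: rec_evalE)
    next
      case Succ
      then show ?thesis
        using q Ev self by (auto simp: goals_met_def elim!: rec_evalE)
    next
      case (Proj k)
      then show ?thesis
        using q Ev self by (auto simp: goals_met_def elim!: rec_evalE)
    next
      case (Comp g gs)
      have zs: "length zs = length gs" "\<And>k. k < length gs \<Longrightarrow> rec_eval (gs ! k) xs (zs ! k)"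
        "rec_eval g zs y" using q(3) Ev Comp by auto
      have sub: "Ev g (length zs) \<in> Q" "\<And>k. k < length gs \<Longrightarrow> Ev (gs ! k) (length xs) \<in> Q"
        using Q[OF q(1)] Ev Comp zs(1) q(2) by auto
      obtain us where us: "valuation n (Ev g (length zs)) zs y us \<in> solution n Q"
        using solution_Ev[OF zs(3) sub(1)] .
      have "\<forall>k\<in>{..<length gs}. \<exists>us. valuation n (Ev (gs ! k) m) xs (zs ! k) us \<in> solution n Q"
        using solution_Ev[OF zs(2) sub(2)] q(2) Ev by (metis arity.simps(1) lessThan_iff)
      then obtain vs where
        vs: "\<And>k. k < length gs \<Longrightarrow> valuation n (Ev (gs ! k) m) xs (zs ! k) (vs k) \<in> solution n Q"
        by (metis lessThan_iff)
      show ?thesis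
        unfolding goals_met_def Ev Comp rules.simps using us zs(1) vs
        by (auto intro: bexI[OF _ us] bexI[OF _ vs])
    next
      case (PrimRec g h)
      \<comment> \<open>For a successor argument \<open>derivable\<close> only records the two
        premises; \<open>prim_Suc\<close> recovers the value.\<close>
      have "rec_eval f xs y"
        using q(3) Ev PrimRec
        by (cases xs; cases "hd xs") (auto intro: rec_eval.intros)
      then obtain x xs' where xs: "xs = x # xs'"
        unfolding PrimRec by (auto elim: rec_evalE)
      have m: "m = Suc (length xs')" using q(2) Ev xs by simp
      have sub: "Ev g (length xs') \<in> Q" "Ev h (Suc (Suc (length xs'))) \<in> Q"
        using Q[OF q(1)] Ev PrimRec m by auto
      show ?thesis
      proof (cases x)
        case 0
        have "rec_eval g xs' y"
          using \<open>rec_eval f xs y\<close> by (auto simp: PrimRec xs 0 elim: rec_evalE)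
        then obtain us where us: "valuation n (Ev g (length xs')) xs' y us \<in> solution n Q"
          using solution_Ev sub(1) by blast
        show ?thesis
          unfolding goals_met_def Ev PrimRec m rules.simps xs 0
          using self us unfolding Ev PrimRec m xs 0
          by (auto intro: bexI[OF _ us])
      next
        case (Suc l)
        have *: "rec_eval (PrimRec g h) (l # xs') (zs ! 0)" "rec_eval h (l # zs ! 0 # xs') y"
          using q(3) Ev PrimRec xs Suc by auto
        obtain us where us:
          "valuation n (Ev (PrimRec g h) m) (l # xs') (zs ! 0) us \<in> solution n Q"
          using solution_Ev[OF *(1)] q(1) Ev PrimRec m by auto
        obtain vs where vs:
          "valuation n (Ev h (Suc m)) (l # zs ! 0 # xs') y vs \<in> solution n Q"
          using solution_Ev[OF *(2)] sub(2) m by auto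
        show ?thesis
          unfolding goals_met_def Ev PrimRec m rules.simps xs Suc
          using us vs unfolding m
          by (auto intro: bexI[OF _ us[unfolded m]] bexI[OF _ vs[unfolded m]])
      qed
    next
      case (Min g)
      have *: "rec_eval g (y # xs) 0" "\<forall>k<y. \<exists>z. rec_eval g (k # xs) (Suc z)"
        using q(3) Ev Min by (auto elim: rec_evalE)
      have sub: "Ev g (Suc m) \<in> Q" "Bel g m \<in> Q"
        using Q[OF q(1)] Ev Min by auto
      obtain us where us: "valuation n (Ev g (Suc m)) (y # xs) 0 us \<in> solution n Q"
        using solution_Ev[OF *(1)] sub(1) q(2) Ev by auto
      obtain vs where vs: "valuation n (Bel g m) (y # xs) 0 vs \<in> solution n Q"
        using solution_Bel[OF *(2)] sub(2) q(2) Ev by auto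
      show ?thesis
        using us vs unfolding goals_met_def Ev Min rules.simps
        by (auto intro: bexI[OF _ us] bexI[OF _ vs])
    qed
  next
    case (Bel f m)
    obtain x xs' where xs: "xs = x # xs'" "length xs' = m"
      using q(2) Bel by (cases xs) auto
    show ?thesis
    proof (cases x)
      case 0
      then show ?thesis
        using self xs unfolding goals_met_def Bel by auto
    next
      case (Suc l)
      have *: "\<forall>k<l. \<exists>z. rec_eval f (k # xs') (Suc z)" "rec_eval f (l # xs') (Suc (zs ! 0))"
        using q(3) Bel xs Suc by auto
      have sub: "Ev f (Suc m) \<in> Q"
        using Q[OF q(1)] Bel by auto
      obtain us where us: "valuation n (Ev f (Suc m)) (l # xs') (Suc (zs ! 0)) us \<in> solution n Q"
        using solution_Ev[OF *(2)] sub xs by auto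
      obtain vs where vs: "valuation n (Bel f m) (l # xs') 0 vs \<in> solution n Q"
        using solution_Bel[OF *(1)] q(1) Bel xs by auto
      show ?thesis
        using us vs unfolding goals_met_def Bel xs Suc rules.simps
        by (auto intro: bexI[OF _ us] bexI[OF _ vs])
    qed
  qed
qed

text \<open>The \<open>t\<close>-th obligations of all judgements are merged, since there is only one next path per
  tick.\<close>

definition judgement_obligation :: "recf \<Rightarrow> nat \<Rightarrow> constraint list list" where
  "judgement_obligation f t = concat (map (\<lambda>q. map ((#) (Const (Cur 1) (to_nat q)))
     (if t < length (rules q) then rules q ! t else [[]])) (judgements f 1))"

text \<open>Imposed on every path, so any nonempty model contains the judgement that
  \<open>f\<close> maps the input to 0.\<close>

definition root_obligation :: "recf \<Rightarrow> constraint list list" where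
  "root_obligation f = [[next_is (Ev f 1), Eq (Nxt (arg 0)) (Cur 0), Const (Nxt 2) 0]]"

text \<open>The sum bounds the number of obligations of each listed judgement; \<open>Suc\<close>
  ensures that index 0 is present.\<close>

definition zero_system :: "recf \<Rightarrow> constraint list list list" where
  "zero_system f = root_obligation f # map (judgement_obligation f)
     [0..<Suc (sum_list (map (length \<circ> rules) (judgements f 1)))]"

lemma rec_eval_of_closed_under:
  assumes "T \<noteq> {}" and input: "\<And>v. v \<in> T \<Longrightarrow> v 0 = n" and closed: "closed_under (zero_system f) T"
  shows "rec_eval f [n] 0"
proof -
  define N where "N = sum_list (map (length \<circ> rules) (judgements f 1))"
  have closed_at: "\<exists>w\<in>T. \<exists>cs\<in>set (judgement_obligation f t). \<forall>c\<in>set cs. holds v w c"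
    if "v \<in> T" "t \<le> N" for v t
  proof -
    have "judgement_obligation f t \<in> set (zero_system f)"
      using that(2) unfolding zero_system_def N_def[symmetric] by (auto simp del: upt_Suc)
    then show ?thesis
      using closed that(1) unfolding closed_under_def by blast
  qed
  have met: "goals_met T q v" if v: "v \<in> T" "v 1 = to_nat q" for q v
    unfolding goals_met_def
  proof
    fix ob assume "ob \<in> set (rules q)"
    then obtain t where t: "t < length (rules q)" "ob = rules q ! t"
      by (auto simp: in_set_conv_nth)
    \<comment> \<open>Every alternative at index 0 fixes track 1 to the code of a listed judgement,
      and \<open>to_nat\<close> is injective.\<close>
    have q: "q \<in> set (judgements f 1)"
      using closed_at[OF v(1), of 0] v(2) by (auto simp: judgement_obligation_def)
    then have "length (rules q) \<le> N"
      unfolding N_def by (intro member_le_sum_list) auto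
    then obtain w cs where w: "w \<in> T" "cs \<in> set (judgement_obligation f t)"
      "\<forall>c\<in>set cs. holds v w c"
      using closed_at[OF v(1), of t] t(1) by auto
    \<comment> \<open>Only alternatives guarded by the code of \<open>q\<close> are compatible with
      track 1 of \<open>v\<close>.\<close>
    then obtain cs' where "cs' \<in> set ob" "\<forall>c\<in>set cs'. holds v w c"
      using v(2) t by (auto simp: judgement_obligation_def)
    then show "\<exists>w\<in>T. \<exists>cs\<in>set ob. \<forall>c\<in>set cs. holds v w c"
      using w(1) by blast
  qed
  obtain w where w: "w \<in> T" "w 1 = to_nat (Ev f 1)" "w (arg 0) = n" "w 2 = 0"
  proof -
    obtain v where "v \<in> T" using assms(1) by blast
    moreover have "root_obligation f \<in> set (zero_system f)"
      by (simp add: zero_system_def)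
    ultimately have "\<exists>w\<in>T. \<exists>cs\<in>set (root_obligation f). \<forall>c\<in>set cs. holds v w c"
      using closed unfolding closed_under_def by blast
    then show ?thesis
      using that input[OF \<open>v \<in> T\<close>] by (auto simp: root_obligation_def)
  qed
  then show ?thesis
    using rules_sound[OF met w(1,2)] by (simp add: args_def)
qed

lemma solution_root:
  assumes "rec_eval f [n] 0"
  obtains us where "valuation n (Ev f 1) [n] 0 us \<in> solution n (set (judgements f 1))"
proof -
  have "Ev f (length [n]) \<in> set (judgements f 1)"
    using judgements_self by simp
  then obtain us where "valuation n (Ev f (length [n])) [n] 0 us \<in> solution n (set (judgements f 1))"
    using solution_Ev[OF assms] by blast
  then show ?thesis using that by simp
qed

lemma closed_under_solution:
  assumes "rec_eval f [n] 0"
  shows "closed_under (zero_system f) (solution n (set (judgements f 1)))"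
    (is "closed_under _ ?T")
  unfolding closed_under_def
proof (intro ballI)
  fix v ob assume "v \<in> ?T" "ob \<in> set (zero_system f)"
  then obtain q xs y zs where
    q: "q \<in> set (judgements f 1)" "length xs = arity q" "derivable q xs y zs"
    and v: "v = valuation n q xs y zs"
    by (auto simp: solution_def)
  from \<open>ob \<in> set (zero_system f)\<close>
  consider "ob = root_obligation f" | t where "ob = judgement_obligation f t"
    unfolding zero_system_def by auto
  then show "\<exists>w\<in>?T. \<exists>cs\<in>set ob. \<forall>c\<in>set cs. holds v w c"
  proof cases
    case 1
    obtain us where us: "valuation n (Ev f 1) [n] 0 us \<in> ?T"
      using solution_root[OF assms] .
    show ?thesis
      unfolding 1 root_obligation_def v by (rule bexI[OF _ us]) simp
  next
    case (2 t)
    obtain w cs where w: "w \<in> ?T" "\<forall>c\<in>set cs. holds v w c"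
      "cs \<in> set (if t < length (rules q) then rules q ! t else [[]])"
    proof (cases "t < length (rules q)")
      case True
      have "goals_met ?T q v"
        unfolding v using solution_goals_met[OF subgoals_judgements q] .
      then show ?thesis
        using True that unfolding goals_met_def by (auto dest!: bspec[OF _ nth_mem[OF True]])
    next
      \<comment> \<open>Here the padding \<open>[[]]\<close> applies: the empty conjunction holds
        for any next valuation.\<close>
      case False
      then show ?thesis
        using that[of v "[]"] \<open>v \<in> ?T\<close> by simp
    qed
    have "Const (Cur 1) (to_nat q) # cs \<in> set ob"
      unfolding 2 judgement_obligation_def using q(1) w(3) by force
    moreover have "\<forall>c\<in>set (Const (Cur 1) (to_nat q) # cs). holds v w c"
      using w(2) by (simp add: v)
    ultimately show ?thesis
      using w(1) by blast
  qed
qed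

lemma satisfiable_iff_rec_eval:
  assumes "infinite (UNIV :: 'n set)"
  shows "satisfiable TYPE('n) (with_input (system (zero_system f)) n) \<longleftrightarrow> rec_eval f [n] 0"
    (is "?l \<longleftrightarrow> ?r")
proof
  assume ?l
  then obtain S :: "'n set" and r L
    where "models S r L (with_input (system (zero_system f)) n)" "Paths S r \<noteq> {}"
    unfolding satisfiable_def by blast
  from closed_under_of_model[OF this] obtain T
    where "T \<noteq> {}" "\<forall>v\<in>T. v 0 = n" "closed_under (zero_system f) T" by blast
  then show ?r
    by (intro rec_eval_of_closed_under) auto
next
  assume ?r
  let ?T = "solution n (set (judgements f 1))"
  have "?T \<noteq> {}"
    using solution_root[OF \<open>?r\<close>] by blast
  moreover have "v 0 = n" if "v \<in> ?T" for v
    using that by (auto simp: solution_def)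
  moreover have "zero_system f \<noteq> []"
    by (simp add: zero_system_def)
  ultimately show ?l
    using closed_under_solution[OF \<open>?r\<close>]
    by (intro satisfiable_of_closed_under[OF assms _ countable_solution]) auto
qed


section \<open>Diagonalisation\<close>

text \<open>Follows the recursion of \<open>number\<close>: 3 and 4 are the tags of
  \<open>And\<close> and \<open>X\<close> in \<open>encode\<close>, and \<open>Proj 1\<close> is the
  code obtained for the predecessor.\<close>

definition number_recf :: recf where
  "number_recf = PrimRec (const_recf (encode (Atom 0 0)))
     (pair_recf (const_recf 3) (pair_recf (const_recf (encode (Neg (Atom 0 0))))
       (pair_recf (const_recf 4) (Proj 1))))"

lemma rec_eval_number: "rec_eval number_recf [n] (encode (number 0 0 n))"
proof (induction n)
  case 0
  show ?case
    unfolding number_recf_def number.simps by (intro prim_0 rec_eval_const)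
next
  case (Suc n)
  show ?case
    unfolding number_recf_def number.simps encode.simps(4,5)
    by (rule prim_Suc, rule Suc[unfolded number_recf_def],
        intro rec_eval_pair rec_eval_const rec_eval_proj) simp_all
qed

text \<open>The input formula is conjoined outside of \<open>\<chi>\<close>, so that the code of \<open>\<chi>\<close> need not be decoded.\<close>

definition self_input_recf :: recf where
  "self_input_recf = pair_recf (const_recf 8) (pair_recf (const_recf 0)
     (pair_recf (const_recf 3) (pair_recf number_recf (Proj 0))))"

lemma rec_eval_self_input:
  "rec_eval self_input_recf [encode \<chi>] (encode (with_input \<chi> (encode \<chi>)))"
  unfolding self_input_recf_def with_input_def encode.simps(4,9)
  by (intro rec_eval_pair rec_eval_const rec_eval_number rec_eval_proj) simp_all

theorem theorem9:
  assumes "infinite (UNIV :: 'n set)"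
  shows "\<not> (\<exists>f. decides f {\<phi>. forall_exists \<phi>} (satisfiable TYPE('n)))"
proof
  assume "\<exists>f. decides f {\<phi>. forall_exists \<phi>} (satisfiable TYPE('n))"
  then obtain f where f: "decides f {\<phi>. forall_exists \<phi>} (satisfiable TYPE('n))" ..
  define F where "F = Comp f [self_input_recf]"
  define \<chi> where "\<chi> = system (zero_system F)"
  define \<phi> where "\<phi> = with_input \<chi> (encode \<chi>)"
  have "forall_exists \<phi>"
    unfolding \<phi>_def \<chi>_def by (rule forall_exists_with_input)
  then have "rec_eval f [encode \<phi>] (if satisfiable TYPE('n) \<phi> then 1 else 0)"
    using f by (simp add: decides_def)
  then have F: "rec_eval F [encode \<chi>] (if satisfiable TYPE('n) \<phi> then 1 else 0)"
    unfolding F_def by (rule rec_eval_comp1[OF rec_eval_self_input[of \<chi>, folded \<phi>_def]])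
  \<comment> \<open>\<open>F\<close> returns 1 on the code of \<open>\<chi>\<close> if
    \<open>\<phi>\<close> is satisfiable and 0 otherwise, the opposite of this equivalence;
    determinism gives the clash.\<close>
  have "satisfiable TYPE('n) \<phi> \<longleftrightarrow> rec_eval F [encode \<chi>] 0"
    using satisfiable_iff_rec_eval[OF assms] by (simp add: \<phi>_def \<chi>_def)
  then show False
    using F by (auto dest: rec_eval_deterministic split: if_splits)
qed

end
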